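(* Let $\beta\in\mathbb{C}\setminus\{0\}$ and $s\in\mathbb{C}$. Then for $p\in\mathbb{C}\setminus\{s\}$ $$\frac{1}{s-p}=-\frac{\beta\,\mathrm{e}^{-\beta s}}{\mathrm{e}^{-\beta s}-\mathrm{e}^{-\beta p}}+\sum_{k=1}^{\infty}\frac{\beta\,2^{-k}\,\mathrm{e}^{-2^{-k}\beta s}}{\mathrm{e}^{-2^{-k}\beta s}+\mathrm{e}^{-2^{-k}\beta p}},$$ and the series converges uniformly for $p$ in compact subsets of $\mathbb{C}\setminus\{s\}$.
   Context: The identity and the convergence are understood with removable singularities removed: individual terms on the right side have poles at points $p\neq s$ with $\beta(p-s)\in2\pi i\mathbb{Z}$, but for every $R>0$ all the partial sums of the right side (first term plus the first $n$ terms of the series) from some $n$ on are analytic, after removal of singularities, in $\{p:0<|p-s|<R\}$; uniform convergence refers to these partial sums. *)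

theory Defs
  imports "HOL-Complex_Analysis.Complex_Analysis"
begin

definition head_term :: "complex \<Rightarrow> complex \<Rightarrow> complex \<Rightarrow> complex" where
  "head_term \<beta> s p =
     - (\<beta> * exp (- \<beta> * s)) / (exp (- \<beta> * s) - exp (- \<beta> * p))"

definition series_term :: "complex \<Rightarrow> complex \<Rightarrow> nat \<Rightarrow> complex \<Rightarrow> complex" where
  "series_term \<beta> s k p =
     \<beta> * (1 / 2) ^ k * exp (- ((1 / 2) ^ k) * \<beta> * s) /
       (exp (- ((1 / 2) ^ k) * \<beta> * s) + exp (- ((1 / 2) ^ k) * \<beta> * p))"

text \<open>
  At a pole of one of its terms, the value of \<open>partial_sum\<close> is an artefact of division by zero.
  The mathematically meaningful function is \<open>remove_sings (partial_sum \<beta> s n)\<close>, whose value at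
  a point is the limit of the partial sum there.  It is \<open>0\<close> where that limit does not exist, so
  it is not continuous at poles of the partial sum itself.
\<close>

definition partial_sum :: "complex \<Rightarrow> complex \<Rightarrow> nat \<Rightarrow> complex \<Rightarrow> complex" where
  "partial_sum \<beta> s n p = head_term \<beta> s p + (\<Sum>k=1..n. series_term \<beta> s k p)"

end

theory Submission imports Defs begin

text \<open>
  Since \<open>1 / (w\<^sup>2 - 1) = (1 / (w - 1) - 1 / (w + 1)) / 2\<close>, taking \<open>w = exp (u / 2 ^ k)\<close> with
  \<open>u = \<beta> (s - p)\<close> makes the series telescope: the \<open>n\<close>-th partial sum is \<open>\<beta> h / (exp (h u) - 1)\<close>
  with \<open>h = 2\<^sup>-\<^sup>n\<close>. Its nonzero singularities \<open>u\<close> have modulus at least \<open>2 ^ n * 2 \<pi>\<close>, and as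
  \<open>h \<rightarrow> 0\<close> it tends to \<open>\<beta> / u\<close> because \<open>v / (exp v - 1) \<rightarrow> 1\<close> as \<open>v \<rightarrow> 0\<close>.
\<close>

section \<open>Telescoped form of the partial sums\<close>

definition telescoped :: "complex \<Rightarrow> complex \<Rightarrow> nat \<Rightarrow> complex \<Rightarrow> complex" where
  "telescoped \<beta> s n p = \<beta> * (1 / 2) ^ n / (exp ((1 / 2) ^ n * (\<beta> * (s - p))) - 1)"

text \<open>The solutions of \<open>exp z = 1\<close> are the integer multiples of
  \<open>2 * pi * \<i>\<close>, and only 0 lies in the open disc of radius
  \<open>2 * pi\<close>.\<close>

lemma exp_eq_1_small:
  fixes z :: complex
  assumes "exp z = 1" "cmod z < 2 * pi"
  shows "z = 0"
proof -
  obtain m :: int where m: "Re z = 0" "Im z = of_int (2 * m) * pi"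
    using assms(1) by (auto simp: exp_eq_1)
  have "\<bar>Im z\<bar> < 2 * pi"
    using abs_Im_le_cmod[of z] assms(2) by linarith
  then have "\<bar>of_int m :: real\<bar> < 1"
    by (simp add: m(2) abs_mult)
  then have "m = 0"
    by linarith
  with m show ?thesis
    by (simp add: complex_eq_iff)
qed

text \<open>Cancel the nonvanishing factor \<open>exp (- \<beta> * s)\<close>. The equation is
  unconditional because at a pole both sides are 0 by division by zero.\<close>

lemma head_term_eq: "head_term \<beta> s p = telescoped \<beta> s 0 p"
proof -
  define w where "w = exp (\<beta> * (s - p))"
  have "exp (- \<beta> * p) = exp (- \<beta> * s) * w"
    by (simp add: w_def algebra_simps flip: exp_add)
  then have "head_term \<beta> s p = - (exp (- \<beta> * s) * \<beta>) / (exp (- \<beta> * s) * (1 - w))"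
    by (simp add: head_term_def algebra_simps)
  also have "\<dots> = - \<beta> / (1 - w)"
    by (simp add: divide_simps)
  also have "\<dots> = \<beta> / (w - 1)"
    by (metis minus_diff_eq minus_divide_divide)
  finally show ?thesis
    by (simp add: telescoped_def w_def)
qed

lemma series_term_eq:
  "series_term \<beta> s k p = \<beta> * (1 / 2) ^ k / (1 + exp ((1 / 2) ^ k * (\<beta> * (s - p))))"
proof -
  define h :: complex where "h = (1 / 2) ^ k"
  define w where "w = exp (h * (\<beta> * (s - p)))"
  have "exp (- h * \<beta> * p) = exp (- h * \<beta> * s) * w"
    by (simp add: w_def algebra_simps flip: exp_add)
  then have "series_term \<beta> s k p =
      (exp (- h * \<beta> * s) * (\<beta> * h)) / (exp (- h * \<beta> * s) * (1 + w))"
    by (simp add: series_term_def h_def algebra_simps)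
  then show ?thesis
    by (simp add: h_def w_def)
qed

text \<open>The hypothesis says \<open>w\<^sup>2 \<noteq> 1\<close> and so excludes both
  \<open>w = 1\<close> and \<open>w = -1\<close>. At \<open>w = -1\<close> the poles of the two
  summands cancel analytically, but division by zero makes the left side 0.\<close>

lemma telescoped_Suc:
  assumes "exp ((1 / 2) ^ n * (\<beta> * (s - p))) \<noteq> 1"
  shows "telescoped \<beta> s n p + series_term \<beta> s (Suc n) p = telescoped \<beta> s (Suc n) p"
proof -
  define h :: complex where "h = (1 / 2) ^ Suc n"
  define w where "w = exp (h * (\<beta> * (s - p)))"
  have sq: "exp ((1 / 2) ^ n * (\<beta> * (s - p))) = w\<^sup>2"
    by (simp add: w_def h_def power2_eq_square algebra_simps flip: exp_add)
  then have "w\<^sup>2 \<noteq> 1"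
    using assms by simp
  then have nz: "w - 1 \<noteq> 0" "1 + w \<noteq> 0" "w\<^sup>2 - 1 \<noteq> 0"
    by (auto simp: power2_eq_1_iff add_eq_0_iff)
  have "\<beta> * (2 * h) / (w\<^sup>2 - 1) + \<beta> * h / (1 + w) = \<beta> * h / (w - 1)"
    using nz by (simp add: divide_simps) (simp add: power2_eq_square algebra_simps)
  moreover have "telescoped \<beta> s n p = \<beta> * (2 * h) / (w\<^sup>2 - 1)"
    by (simp only: telescoped_def sq) (simp add: h_def)
  moreover have "series_term \<beta> s (Suc n) p = \<beta> * h / (1 + w)"
    by (simp only: series_term_eq w_def h_def)
  moreover have "telescoped \<beta> s (Suc n) p = \<beta> * h / (w - 1)"
    by (simp only: telescoped_def w_def h_def)
  ultimately show ?thesis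
    by simp
qed

lemma partial_sum_eq_telescoped:
  assumes "exp (\<beta> * (s - p)) \<noteq> 1"
  shows "partial_sum \<beta> s n p = telescoped \<beta> s n p"
proof (induction n)
  case 0
  then show ?case
    by (simp add: partial_sum_def head_term_eq)
next
  case (Suc n)
  \<comment> \<open>If the root \<open>exp (u / 2 ^ n)\<close> were 1, so would be its power
    \<open>exp u\<close>; hence the assumption at level 0 serves every level.\<close>
  have "exp ((1 / 2) ^ n * (\<beta> * (s - p))) ^ (2 ^ n) = exp (\<beta> * (s - p))"
    by (simp add: power_divide flip: exp_of_nat_mult)
  then have "exp ((1 / 2) ^ n * (\<beta> * (s - p))) \<noteq> 1"
    using assms by auto
  from telescoped_Suc[OF this] Suc show ?case
    by (simp add: partial_sum_def flip: add.assoc)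
qed

section \<open>Removal of singularities\<close>

lemma eventually_exp_neq_1:
  fixes \<beta> s z :: complex
  assumes "\<beta> \<noteq> 0"
  shows "\<forall>\<^sub>F p in at z. exp (\<beta> * (s - p)) \<noteq> 1"
proof (cases "exp (\<beta> * (s - z)) = 1")
  case False
  have "((\<lambda>p. exp (\<beta> * (s - p))) \<longlongrightarrow> exp (\<beta> * (s - z))) (at z)"
    by (intro tendsto_intros)
  then show ?thesis
    using False by (rule tendsto_imp_eventually_ne)
next
  \<comment> \<open>The exceptional points are isolated: here \<open>exp (\<beta> * (s - p))\<close>
    equals \<open>exp (\<beta> * (z - p))\<close>, which is not 1 while \<open>p \<noteq> z\<close>
    and the exponent has modulus below \<open>2 * pi\<close>.\<close>
  case True
  have "((\<lambda>p. cmod (\<beta> * (z - p))) \<longlongrightarrow> cmod (\<beta> * (z - z))) (at z)"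
    by (intro tendsto_intros)
  then have "\<forall>\<^sub>F p in at z. cmod (\<beta> * (z - p)) < 2 * pi"
    by (rule order_tendstoD) simp
  moreover have "\<forall>\<^sub>F p in at z. p \<noteq> z"
    by (simp add: eventually_at_filter)
  ultimately show ?thesis
  proof eventually_elim
    case (elim p)
    have "exp (\<beta> * (s - p)) = exp (\<beta> * (s - z)) * exp (\<beta> * (z - p))"
      by (simp add: algebra_simps flip: exp_add)
    then show ?case
      using True elim assms exp_eq_1_small[of "\<beta> * (z - p)"] by auto
  qed
qed

text \<open>\<open>remove_sings\<close> depends only on the values in a punctured neighbourhood, so
  agreement off the isolated exceptional points gives equality everywhere, even at poles of single
  terms.\<close>

lemma remove_sings_partial_sum:
  assumes "\<beta> \<noteq> 0"
  shows "remove_sings (partial_sum \<beta> s n) = remove_sings (telescoped \<beta> s n)"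
proof
  fix z
  have "\<forall>\<^sub>F p in at z. partial_sum \<beta> s n p = telescoped \<beta> s n p"
    using eventually_exp_neq_1[OF assms, of s z]
    by eventually_elim (rule partial_sum_eq_telescoped)
  then show "remove_sings (partial_sum \<beta> s n) z = remove_sings (telescoped \<beta> s n) z"
    by (rule remove_sings_cong) simp
qed

lemma telescoped_denominator_neq_0:
  assumes "\<beta> \<noteq> 0" "p \<noteq> s" "cmod \<beta> * cmod (p - s) < 2 ^ n * (2 * pi)"
  shows "exp ((1 / 2) ^ n * (\<beta> * (s - p))) \<noteq> 1"
proof
  assume "exp ((1 / 2) ^ n * (\<beta> * (s - p))) = 1"
  moreover have "cmod ((1 / 2) ^ n * (\<beta> * (s - p))) = cmod \<beta> * cmod (p - s) / 2 ^ n"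
    by (simp add: norm_mult norm_power norm_divide norm_minus_commute power_divide)
  with assms(3) have "cmod ((1 / 2) ^ n * (\<beta> * (s - p))) < 2 * pi"
    by (simp add: divide_less_eq mult.commute)
  ultimately have "(1 / 2) ^ n * (\<beta> * (s - p)) = 0"
    by (rule exp_eq_1_small)
  with assms show False
    by simp
qed

lemma telescoped_analytic:
  assumes "\<beta> \<noteq> 0" "\<And>p. p \<in> A \<Longrightarrow> p \<noteq> s"
    "\<And>p. p \<in> A \<Longrightarrow> cmod \<beta> * cmod (p - s) < 2 ^ n * (2 * pi)"
  shows "telescoped \<beta> s n analytic_on A"
  unfolding telescoped_def
  using telescoped_denominator_neq_0[OF assms(1)] assms by (intro analytic_intros) auto

lemma remove_sings_partial_sum_eq:
  assumes "\<beta> \<noteq> 0" "p \<noteq> s" "cmod \<beta> * cmod (p - s) < 2 ^ n * (2 * pi)"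
  shows "remove_sings (partial_sum \<beta> s n) p = telescoped \<beta> s n p"
proof -
  have "telescoped \<beta> s n analytic_on {p}"
    using assms by (intro telescoped_analytic) auto
  then show ?thesis
    by (simp add: remove_sings_partial_sum[OF assms(1)] remove_sings_at_analytic)
qed

section \<open>Uniform convergence on compact sets\<close>

lemma eventually_less_2_power:
  fixes c B :: real
  assumes "c > 0"
  shows "\<forall>\<^sub>F n in sequentially. B < 2 ^ n * c"
proof -
  have "filterlim (\<lambda>n. 2 ^ n * c) at_top sequentially"
    using assms by real_asymp
  then show ?thesis
    by (simp add: filterlim_at_top_dense)
qed

text \<open>This is the reciprocal of the difference quotient of \<open>exp\<close> at 0, where the
  derivative is 1.\<close>

lemma tendsto_ratio_exp_minus_1:
  "(\<lambda>v::complex. v / (exp v - 1)) \<midarrow>0\<rightarrow> 1"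
proof -
  have "(exp has_field_derivative 1) (at (0::complex))"
    using DERIV_exp[of 0] by simp
  then have "(\<lambda>v::complex. (exp v - 1) / v) \<midarrow>0\<rightarrow> 1"
    by (simp add: DERIV_def)
  from tendsto_inverse[OF this] show ?thesis
    by simp
qed

text \<open>With \<open>v = (1 / 2) ^ n * (\<beta> * (s - p))\<close>, the telescoped sum is
  \<open>1 / (s - p)\<close> times \<open>v / (exp v - 1)\<close>. On \<open>K\<close> the first
  factor is bounded by some \<open>C\<close>, since \<open>K\<close> is compact and avoids
  \<open>s\<close>, and \<open>v\<close> tends to 0 uniformly.\<close>

lemma uniform_limit_telescoped:
  assumes "\<beta> \<noteq> 0" "compact K" "K \<subseteq> - {s}"
  shows "uniform_limit K (telescoped \<beta> s) (\<lambda>p. 1 / (s - p)) sequentially"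
proof (rule uniform_limitI)
  fix e :: real
  assume "e > 0"
  have "compact ((\<lambda>p. 1 / (s - p)) ` K)"
    using assms by (intro compact_continuous_image continuous_intros) auto
  then obtain C where C: "C > 0" "\<And>p. p \<in> K \<Longrightarrow> cmod (1 / (s - p)) \<le> C"
    by (force dest!: compact_imp_bounded simp: bounded_pos)
  have "compact ((\<lambda>p. \<beta> * (s - p)) ` K)"
    using assms by (intro compact_continuous_image continuous_intros)
  then obtain B where B: "\<And>p. p \<in> K \<Longrightarrow> cmod (\<beta> * (s - p)) \<le> B"
    by (force dest!: compact_imp_bounded simp: bounded_pos)
  have "e / C > 0"
    using \<open>e > 0\<close> C(1) by simp
  then obtain d where d: "d > 0"
    "\<And>v::complex. v \<noteq> 0 \<Longrightarrow> cmod v < d \<Longrightarrow> cmod (v / (exp v - 1) - 1) < e / C"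
    using LIM_D[OF tendsto_ratio_exp_minus_1] by (metis diff_zero)
  \<comment> \<open>Once \<open>B < 2 ^ n * d\<close>, the bound \<open>cmod v < d\<close> holds for
    all \<open>p\<close> in \<open>K\<close> at once.\<close>
  show "\<forall>\<^sub>F n in sequentially. \<forall>p\<in>K. dist (telescoped \<beta> s n p) (1 / (s - p)) < e"
    using eventually_less_2_power[OF d(1), of B]
  proof eventually_elim
    case (elim n)
    show ?case
    proof
      fix p
      assume p: "p \<in> K"
      define v where "v = (1 / 2) ^ n * (\<beta> * (s - p))"
      have ps: "s - p \<noteq> 0"
        using p assms(3) by auto
      have "cmod (\<beta> * (s - p)) < 2 ^ n * d"
        using B[OF p] elim by linarith
      then have "cmod v < d"
        by (simp add: v_def norm_mult norm_power norm_divide field_simps)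
      moreover have "v \<noteq> 0"
        using ps assms(1) by (simp add: v_def)
      ultimately have less: "cmod (v / (exp v - 1) - 1) < e / C"
        by (intro d(2))
      have "telescoped \<beta> s n p = 1 / (s - p) * (v / (exp v - 1))"
        using ps by (simp add: telescoped_def v_def)
      then have "telescoped \<beta> s n p - 1 / (s - p) = 1 / (s - p) * (v / (exp v - 1) - 1)"
        by (simp add: right_diff_distrib)
      then have "dist (telescoped \<beta> s n p) (1 / (s - p)) =
          cmod (1 / (s - p)) * cmod (v / (exp v - 1) - 1)"
        by (simp only: dist_norm norm_mult)
      also have "\<dots> \<le> C * cmod (v / (exp v - 1) - 1)"
        using C(2)[OF p] by (intro mult_right_mono) auto
      also have "\<dots> < C * (e / C)"
        using less C(1) by (intro mult_strict_left_mono)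
      finally show "dist (telescoped \<beta> s n p) (1 / (s - p)) < e"
        using C(1) by simp
    qed
  qed
qed

text \<open>For large \<open>n\<close> the nonzero singularities have left a disc around
  \<open>s\<close> containing \<open>K\<close>, so the partial sums with singularities removed agree
  with \<open>telescoped\<close> on all of \<open>K\<close> and inherit its limit.\<close>

lemma uniform_limit_partial_sum:
  assumes "\<beta> \<noteq> 0" "compact K" "K \<subseteq> - {s}"
  shows "uniform_limit K (\<lambda>n. remove_sings (partial_sum \<beta> s n)) (\<lambda>p. 1 / (s - p)) sequentially"
proof -
  have "compact ((\<lambda>p. p - s) ` K)"
    using assms by (intro compact_continuous_image continuous_intros)
  then obtain B where B: "\<And>p. p \<in> K \<Longrightarrow> cmod (p - s) \<le> B"
    by (force dest!: compact_imp_bounded simp: bounded_pos)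
  have "\<forall>\<^sub>F n in sequentially. cmod \<beta> * B < 2 ^ n * (2 * pi)"
    by (rule eventually_less_2_power) simp
  then have "\<forall>\<^sub>F n in sequentially. \<forall>p\<in>K.
      remove_sings (partial_sum \<beta> s n) p = telescoped \<beta> s n p"
  proof eventually_elim
    case (elim n)
    show ?case
    proof
      fix p
      assume p: "p \<in> K"
      have "cmod \<beta> * cmod (p - s) \<le> cmod \<beta> * B"
        using B[OF p] by (intro mult_left_mono) auto
      also note elim
      finally show "remove_sings (partial_sum \<beta> s n) p = telescoped \<beta> s n p"
        using p assms by (intro remove_sings_partial_sum_eq) auto
    qed
  qed
  then show ?thesis
    using uniform_limit_telescoped[OF assms] by (subst uniform_limit_cong) auto
qed

section \<open>Analyticity in punctured discs and the ordinary series\<close>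

lemma remove_sings_partial_sum_analytic:
  assumes "\<beta> \<noteq> 0" "cmod \<beta> * R \<le> 2 ^ n * (2 * pi)"
  shows "remove_sings (partial_sum \<beta> s n) analytic_on {p. 0 < cmod (p - s) \<and> cmod (p - s) < R}"
    (is "_ analytic_on ?A")
proof -
  have less: "cmod \<beta> * cmod (p - s) < 2 ^ n * (2 * pi)" if "p \<in> ?A" for p
    using that assms by (intro less_le_trans[OF _ assms(2)] mult_strict_left_mono) auto
  have "telescoped \<beta> s n analytic_on ?A"
    using less assms(1) by (intro telescoped_analytic) auto
  moreover have "remove_sings (partial_sum \<beta> s n) p = telescoped \<beta> s n p" if "p \<in> ?A" for p
    using that less assms(1) by (intro remove_sings_partial_sum_eq) auto
  \<comment> \<open>On an open set analyticity is holomorphy, which transfers along an equality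
    known only on that set.\<close>
  moreover have "open ?A"
    by (intro open_Collect_conj open_Collect_less continuous_intros)
  ultimately show ?thesis
    by (metis (no_types, lifting) analytic_on_open holomorphic_cong)
qed

text \<open>The hypothesis avoids the poles of all the terms, so the raw partial sums are already
  the telescoped ones and this is an ordinary convergent series.\<close>

lemma series_term_sums:
  assumes "\<beta> \<noteq> 0" "exp (\<beta> * (s - p)) \<noteq> 1"
  shows "(\<lambda>k. series_term \<beta> s (Suc k) p) sums (1 / (s - p) - head_term \<beta> s p)"
proof -
  have "p \<noteq> s"
    using assms(2) by auto
  then have "(\<lambda>n. telescoped \<beta> s n p) \<longlonglongrightarrow> 1 / (s - p)"
    using uniform_limit_telescoped[OF assms(1), of "{p}" s] by (auto intro: tendsto_uniform_limitI)
  then have "(\<lambda>n. telescoped \<beta> s n p - head_term \<beta> s p) \<longlonglongrightarrow> 1 / (s - p) - head_term \<beta> s p"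
    by (intro tendsto_intros)
  moreover have "telescoped \<beta> s n p - head_term \<beta> s p = (\<Sum>k<n. series_term \<beta> s (Suc k) p)" for n
    using partial_sum_eq_telescoped[OF assms(2), of n]
    by (simp add: partial_sum_def sum.atLeast1_atMost_eq eq_diff_eq add.commute diff_eq_eq)
  ultimately show ?thesis
    by (simp add: sums_def)
qed

text \<open>The lattice of multiples of \<open>2 * pi * \<i>\<close> is symmetric, so passing from
  \<open>p - s\<close> to \<open>s - p\<close> only replaces \<open>m\<close> by
  \<open>- m\<close>.\<close>

lemma exp_neq_1_off_lattice:
  fixes \<beta> s p :: complex
  assumes "\<forall>m::int. \<beta> * (p - s) \<noteq> 2 * complex_of_real pi * \<i> * of_int m"
  shows "exp (\<beta> * (s - p)) \<noteq> 1"
proof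
  assume "exp (\<beta> * (s - p)) = 1"
  then obtain m :: int where "Re (\<beta> * (s - p)) = 0" "Im (\<beta> * (s - p)) = of_int (2 * m) * pi"
    unfolding exp_eq_1 by blast
  then have "\<beta> * (s - p) = 2 * complex_of_real pi * \<i> * of_int m"
    by (simp add: complex_eq_iff)
  then have "\<beta> * (p - s) = 2 * complex_of_real pi * \<i> * of_int (- m)"
    by (metis minus_diff_eq mult_minus_right of_int_minus)
  with assms show False
    by blast
qed

theorem corollary6:
  fixes \<beta> s :: complex
  assumes "\<beta> \<noteq> 0"
  shows "(\<forall>R>0. \<exists>N. \<forall>n\<ge>N.
           remove_sings (partial_sum \<beta> s n) analytic_on {p. 0 < cmod (p - s) \<and> cmod (p - s) < R}) \<and>
         (\<forall>p. p \<noteq> s \<longrightarrow>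
           (\<lambda>n. remove_sings (partial_sum \<beta> s n) p) \<longlonglongrightarrow> 1 / (s - p)) \<and>
         (\<forall>p. (\<forall>m::int. \<beta> * (p - s) \<noteq> 2 * complex_of_real pi * \<i> * of_int m) \<longrightarrow>
           summable (\<lambda>k. series_term \<beta> s (Suc k) p) \<and>
           1 / (s - p) = head_term \<beta> s p + (\<Sum>k. series_term \<beta> s (Suc k) p)) \<and>
         (\<forall>K. compact K \<and> K \<subseteq> - {s} \<longrightarrow>
           uniform_limit K (\<lambda>n. remove_sings (partial_sum \<beta> s n)) (\<lambda>p. 1 / (s - p)) sequentially)"
proof (intro conjI allI impI)
  fix R :: real
  \<comment> \<open>From this \<open>N\<close> on, the nonzero singularities lie outside the disc of
    radius \<open>R\<close> around \<open>s\<close>.\<close>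
  obtain N where N: "\<And>n. n \<ge> N \<Longrightarrow> cmod \<beta> * R < 2 ^ n * (2 * pi)"
    using eventually_less_2_power[of "2 * pi" "cmod \<beta> * R"] by (auto simp: eventually_sequentially)
  show "\<exists>N. \<forall>n\<ge>N.
      remove_sings (partial_sum \<beta> s n) analytic_on {p. 0 < cmod (p - s) \<and> cmod (p - s) < R}"
    using N less_imp_le by (blast intro: remove_sings_partial_sum_analytic[OF assms])
next
  fix p
  assume "p \<noteq> s"
  then show "(\<lambda>n. remove_sings (partial_sum \<beta> s n) p) \<longlonglongrightarrow> 1 / (s - p)"
    using uniform_limit_partial_sum[OF assms, of "{p}" s] by (auto intro: tendsto_uniform_limitI)
next
  fix p
  assume "\<forall>m::int. \<beta> * (p - s) \<noteq> 2 * complex_of_real pi * \<i> * of_int m"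
  then have sums: "(\<lambda>k. series_term \<beta> s (Suc k) p) sums (1 / (s - p) - head_term \<beta> s p)"
    by (intro series_term_sums assms exp_neq_1_off_lattice)
  show "summable (\<lambda>k. series_term \<beta> s (Suc k) p)"
    using sums by (rule sums_summable)
  show "1 / (s - p) = head_term \<beta> s p + (\<Sum>k. series_term \<beta> s (Suc k) p)"
    using sums_unique[OF sums] by (simp add: algebra_simps)
next
  fix K
  assume "compact K \<and> K \<subseteq> - {s}"
  then show "uniform_limit K (\<lambda>n. remove_sings (partial_sum \<beta> s n)) (\<lambda>p. 1 / (s - p)) sequentially"
    by (intro uniform_limit_partial_sum assms) auto
qed

end
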